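(* Let $\mathcal{P}$ be a finite set of price vectors, let $\mathcal{U}$ be a convex set, and suppose $R(\mathbf{p},\mathbf{u})$ is convex in $\mathbf{u}\in\mathcal{U}$ for every $\mathbf{p}\in\mathcal{P}$. Let $K_1,K_2$ be nonnegative integers, let $g_1,\dots,g_{K_1},h_1,\dots,h_{K_2}:\mathcal{P}\to\mathbb{R}$, let $c_1,\dots,c_{K_1},d_1,\dots,d_{K_2}\in\mathbb{R}$, and let $$\tilde\Delta_{\mathcal{P}} = \Big\{\boldsymbol{\pi}\in\Delta_{\mathcal{P}} : \sum_{\mathbf{p}\in\mathcal{P}} g_k(\mathbf{p})\pi_{\mathbf{p}} = c_k\ \forall k\in[K_1],\ \sum_{\mathbf{p}\in\mathcal{P}} h_k(\mathbf{p})\pi_{\mathbf{p}} \le d_k\ \forall k\in[K_2]\Big\},$$ assumed nonempty. Then the optimal value of $$\max_{\boldsymbol{\pi}\in\tilde\Delta_{\mathcal{P}}} \min_{\mathbf{u}\in\mathcal{U}} \sum_{\mathbf{p}\in\mathcal{P}} \pi_{\mathbf{p}} R(\mathbf{p},\mathbf{u})$$ equals the optimal value of the convex optimization problem $$\text{minimize}\quad t - \sum_{k=1}^{K_1}\lambda_k c_k - \sum_{k=1}^{K_2}\rho_k d_k$$ over $\boldsymbol{\lambda}\in\mathbb{R}^{K_1}$, $\boldsymbol{\rho}\in\mathbb{R}^{K_2}$ with $\boldsymbol{\rho}\le\mathbf{0}$ (componentwise), $t\in\mathbb{R}$, $\mathbf{u}\in\mathcal{U}$, subject to $$t \ge R(\mathbf{p},\mathbf{u})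 + \sum_{k=1}^{K_1}\lambda_k g_k(\mathbf{p}) + \sum_{k=1}^{K_2}\rho_k h_k(\mathbf{p})\quad \forall\,\mathbf{p}\in\mathcal{P}.$$
   Context: $\mathcal{P}\subseteq\mathbb{R}_+^I$ is (nonempty and) finite, $\mathcal{U}\subseteq\mathbb{R}^M$ is (nonempty and) convex, $R:\mathcal{P}\times\mathcal{U}\to\mathbb{R}$, $[K]=\{1,\dots,K\}$, and $\Delta_{\mathcal{P}} = \{\boldsymbol{\pi}\in\mathbb{R}^{\mathcal{P}} : \sum_{\mathbf{p}\in\mathcal{P}}\pi_{\mathbf{p}}=1,\ \pi_{\mathbf{p}}\ge 0\ \forall \mathbf{p}\in\mathcal{P}\}$. Optimal values are understood as suprema/infima. *)

theory Defs
  imports "HOL-Analysis.Analysis"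
begin

text \<open>
  \<open>\<real>\<^sup>A\<close> for an explicit index set \<open>A\<close> is rendered as the extensional function space
  \<open>A \<rightarrow>\<^sub>E UNIV\<close>.  In particular \<open>\<real>\<^sup>K\<close> is \<open>{1..K} \<rightarrow>\<^sub>E UNIV\<close>, which also covers
  \<open>K = 0\<close> (a single point).
\<close>

definition prob_simplex :: "'p set \<Rightarrow> ('p \<Rightarrow> real) set" where
  "prob_simplex P = {\<pi> \<in> P \<rightarrow>\<^sub>E UNIV. (\<Sum>p\<in>P. \<pi> p) = 1 \<and> (\<forall>p\<in>P. 0 \<le> \<pi> p)}"

definition constrained_simplex ::
  "'p set \<Rightarrow> nat \<Rightarrow> nat \<Rightarrow> (nat \<Rightarrow> 'p \<Rightarrow> real) \<Rightarrow> (nat \<Rightarrow> 'p \<Rightarrow> real)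
    \<Rightarrow> (nat \<Rightarrow> real) \<Rightarrow> (nat \<Rightarrow> real) \<Rightarrow> ('p \<Rightarrow> real) set" where
  "constrained_simplex P K1 K2 g h c d =
     {\<pi> \<in> prob_simplex P.
        (\<forall>k\<in>{1..K1}. (\<Sum>p\<in>P. g k p * \<pi> p) = c k) \<and>
        (\<forall>k\<in>{1..K2}. (\<Sum>p\<in>P. h k p * \<pi> p) \<le> d k)}"

definition feasible_set ::
  "'p set \<Rightarrow> 'u set \<Rightarrow> ('p \<Rightarrow> 'u \<Rightarrow> real) \<Rightarrow> nat \<Rightarrow> nat
    \<Rightarrow> (nat \<Rightarrow> 'p \<Rightarrow> real) \<Rightarrow> (nat \<Rightarrow> 'p \<Rightarrow> real)
    \<Rightarrow> ((nat \<Rightarrow> real) \<times> (nat \<Rightarrow> real) \<times> real \<times> 'u) set" where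
  "feasible_set P U R K1 K2 g h =
     {(l, \<rho>, t, u). l \<in> {1..K1} \<rightarrow>\<^sub>E UNIV \<and> \<rho> \<in> {1..K2} \<rightarrow>\<^sub>E UNIV \<and>
        (\<forall>k\<in>{1..K2}. \<rho> k \<le> 0) \<and> u \<in> U \<and>
        (\<forall>p\<in>P. t \<ge> R p u + (\<Sum>k=1..K1. l k * g k p) + (\<Sum>k=1..K2. \<rho> k * h k p))}"

definition objective ::
  "nat \<Rightarrow> nat \<Rightarrow> (nat \<Rightarrow> real) \<Rightarrow> (nat \<Rightarrow> real)
    \<Rightarrow> (nat \<Rightarrow> real) \<times> (nat \<Rightarrow> real) \<times> real \<times> 'u \<Rightarrow> real" where
  "objective K1 K2 c d = (\<lambda>(l, \<rho>, t, u). t - (\<Sum>k=1..K1. l k * c k) - (\<Sum>k=1..K2. \<rho> k * d k))"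

text \<open>
  The function type \<open>nat \<Rightarrow> real\<close> is not an instance of \<^class>\<open>real_vector\<close>, so convexity of a
  set of, and of a function on, tuples in \<open>\<real>\<^sup>K1 \<times> \<real>\<^sup>K2 \<times> \<real> \<times> 'u\<close> is spelled out using the
  componentwise convex combination.
\<close>

definition tuple_comb ::
  "nat \<Rightarrow> nat \<Rightarrow> real \<Rightarrow> (nat \<Rightarrow> real) \<times> (nat \<Rightarrow> real) \<times> real \<times> 'u::real_vector
    \<Rightarrow> (nat \<Rightarrow> real) \<times> (nat \<Rightarrow> real) \<times> real \<times> 'u
    \<Rightarrow> (nat \<Rightarrow> real) \<times> (nat \<Rightarrow> real) \<times> real \<times> 'u" where
  "tuple_comb K1 K2 s = (\<lambda>(l, \<rho>, t, u) (l', \<rho>', t', u').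
     (\<lambda>k\<in>{1..K1}. (1 - s) * l k + s * l' k,
      \<lambda>k\<in>{1..K2}. (1 - s) * \<rho> k + s * \<rho>' k,
      (1 - s) * t + s * t',
      (1 - s) *\<^sub>R u + s *\<^sub>R u'))"

definition convex_program ::
  "nat \<Rightarrow> nat \<Rightarrow> ((nat \<Rightarrow> real) \<times> (nat \<Rightarrow> real) \<times> real \<times> 'u::real_vector) set
    \<Rightarrow> ((nat \<Rightarrow> real) \<times> (nat \<Rightarrow> real) \<times> real \<times> 'u \<Rightarrow> real) \<Rightarrow> bool" where
  "convex_program K1 K2 F f \<longleftrightarrow>
     (\<forall>x\<in>F. \<forall>y\<in>F. \<forall>s\<in>{0..1}.
        tuple_comb K1 K2 s x y \<in> F \<and>
        f (tuple_comb K1 K2 s x y) \<le> (1 - s) * f x + s * f y)"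

end

theory Submission
  imports Defs
begin

text \<open>
  Price the constraints into the Lagrangian
  \<open>L p (\<lambda>, \<rho>, u) = R p u + \<Sum>\<^sub>k \<lambda>\<^sub>k (g\<^sub>k p - c\<^sub>k) + \<Sum>\<^sub>k \<rho>\<^sub>k (h\<^sub>k p - d\<^sub>k)\<close>, where \<open>\<rho> \<le> 0\<close>.
  For \<open>\<pi>\<close> in the full simplex, the infimum of \<open>\<Sum>\<^sub>p \<pi>\<^sub>p L p v\<close> over \<open>v = (\<lambda>, \<rho>, u)\<close> is the inner
  minimum of the robust problem if \<open>\<pi>\<close> satisfies the constraints and \<open>-\<infinity>\<close> otherwise, while the
  infimum of \<open>max\<^sub>p L p v\<close> is the value of the convex program, \<open>t\<close> being an epigraph variable.
  So the two values agree by a single minimax theorem for finitely many convex functions \<open>f\<^sub>p\<close>, which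
  amounts to: if \<open>max\<^sub>p f\<^sub>p \<ge> 0\<close> everywhere, then some convex combination of the \<open>f\<^sub>p\<close> is nonnegative.
  For two functions the admissible weights form an interval.  For more, the induction hypothesis on
  \<open>{f\<^sub>q < 0}\<close> combines all functions but \<open>f\<^sub>q\<close> into one that is nonnegative there, leaving two.
\<close>

section \<open>A minimax theorem for finite convexlike families\<close>

text \<open>
  Ky Fan's substitute for convexity.  It asks for no linear structure on the domain, and the type
  \<open>nat \<Rightarrow> real\<close> of the multipliers has none.
\<close>

definition convexlike_on :: "'v set \<Rightarrow> ('v \<Rightarrow> real) set \<Rightarrow> bool" where
  "convexlike_on V S \<longleftrightarrow>
     (\<forall>x\<in>V. \<forall>y\<in>V. \<forall>s\<in>{0..1}. \<exists>z\<in>V. \<forall>f\<in>S. f z \<le> (1 - s) * f x + s * f y)"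

lemma convexlike_onE:
  assumes "convexlike_on V S" and "x \<in> V" and "y \<in> V" and "s \<in> {0..1}"
  obtains z where "z \<in> V" and "\<And>f. f \<in> S \<Longrightarrow> f z \<le> (1 - s) * f x + s * f y"
  using assms unfolding convexlike_on_def by blast

lemma convexlike_on_subset:
  assumes "convexlike_on V S" and "T \<subseteq> S"
  shows "convexlike_on V T"
  using assms unfolding convexlike_on_def by (meson subsetD)

lemma convexlike_on_strict_sublevel:
  assumes "convexlike_on V S" and "f \<in> S"
  shows "convexlike_on {v \<in> V. f v < r} S"
  unfolding convexlike_on_def
proof (intro ballI)
  fix x y and s :: real
  assume x: "x \<in> {v \<in> V. f v < r}" and y: "y \<in> {v \<in> V. f v < r}" and s: "s \<in> {0..1}"
  then obtain z where z: "z \<in> V" "\<And>f. f \<in> S \<Longrightarrow> f z \<le> (1 - s) * f x + s * f y"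
    using convexlike_onE[OF assms(1)] by blast
  have "(1 - s) * f x + s * f y < r"
    using x y s by (intro convex_bound_lt) auto
  then have "f z < r"
    using z(2)[OF assms(2)] by linarith
  with z show "\<exists>z\<in>{v \<in> V. f v < r}. \<forall>f\<in>S. f z \<le> (1 - s) * f x + s * f y"
    by blast
qed

lemma convexlike_on_insert_weighted_sum:
  assumes "convexlike_on V S" and "F ` Q \<subseteq> S" and "\<And>q. q \<in> Q \<Longrightarrow> 0 \<le> w q"
  shows "convexlike_on V (insert (\<lambda>v. \<Sum>q\<in>Q. w q * F q v) S)"
  unfolding convexlike_on_def
proof (intro ballI)
  fix x y and s :: real
  assume "x \<in> V" "y \<in> V" "s \<in> {0..1}"
  then obtain z where z: "z \<in> V" "\<And>f. f \<in> S \<Longrightarrow> f z \<le> (1 - s) * f x + s * f y"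
    using convexlike_onE[OF assms(1)] by blast
  have "(\<Sum>q\<in>Q. w q * F q z) \<le> (\<Sum>q\<in>Q. w q * ((1 - s) * F q x + s * F q y))"
    using z(2) assms(2,3) by (intro sum_mono mult_left_mono) auto
  also have "\<dots> = (1 - s) * (\<Sum>q\<in>Q. w q * F q x) + s * (\<Sum>q\<in>Q. w q * F q y)"
    by (simp add: distrib_left sum.distrib sum_distrib_left mult.left_commute)
  finally show "\<exists>z\<in>V. \<forall>f\<in>insert (\<lambda>v. \<Sum>q\<in>Q. w q * F q v) S. f z \<le> (1 - s) * f x + s * f y"
    using z by blast
qed

lemma convexlike_on_diff_const:
  assumes "convexlike_on V (F ` P)"
  shows "convexlike_on V ((\<lambda>p v. F p v - \<alpha>) ` P)"
  using assms by (simp add: convexlike_on_def algebra_simps)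

lemma convexlike_on_pair_crossing_le:
  assumes "convexlike_on V {a, b}" and nonneg: "\<And>v. v \<in> V \<Longrightarrow> 0 \<le> a v \<or> 0 \<le> b v"
    and x: "x \<in> V" "a x < 0" and y: "y \<in> V" "b y < 0"
  shows "b y / (b y - a y) \<le> b x / (b x - a x)"
proof (rule ccontr)
  assume not_le: "\<not> ?thesis"
  have "0 \<le> b x" "0 \<le> a y"
    using nonneg[OF x(1)] nonneg[OF y(1)] x(2) y(2) by auto
  with x(2) y(2) have pos: "0 < b x - a x" "0 < a y - b y" "0 < b x - b y" "0 < a y - a x"
    by auto
  have "a y * b x < a x * b y"
    using not_le pos by (simp add: divide_simps) (simp add: algebra_simps)
  then have "b x / (b x - b y) < - a x / (a y - a x)"
    using pos by (simp add: divide_simps) (simp add: algebra_simps)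
  then obtain s where s: "b x / (b x - b y) < s" "s < - a x / (a y - a x)"
    using dense by blast
  have "0 \<le> b x / (b x - b y)" "- a x / (a y - a x) \<le> 1"
    using \<open>0 \<le> b x\<close> \<open>0 \<le> a y\<close> pos by (simp_all add: divide_simps)
  with s have "s \<in> {0..1}" by simp
  then obtain z where z: "z \<in> V" "\<And>f. f \<in> {a, b} \<Longrightarrow> f z \<le> (1 - s) * f x + s * f y"
    using convexlike_onE[OF assms(1) x(1) y(1)] by blast
  have "(1 - s) * a x + s * a y < 0" "(1 - s) * b x + s * b y < 0"
    using s pos by (simp_all add: divide_simps algebra_simps)
  with z(2)[of a] z(2)[of b] have "a z < 0" "b z < 0" by auto
  with nonneg[OF z(1)] show False by auto
qed

lemma exists_between_subsets_atLeastAtMost: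
  fixes lo hi :: "'a::conditionally_complete_linorder"
  assumes "lo \<le> hi" and "A \<subseteq> {lo..hi}" and "B \<subseteq> {lo..hi}"
    and "\<And>\<alpha> \<beta>. \<alpha> \<in> A \<Longrightarrow> \<beta> \<in> B \<Longrightarrow> \<alpha> \<le> \<beta>"
  shows "\<exists>s\<in>{lo..hi}. (\<forall>\<alpha>\<in>A. \<alpha> \<le> s) \<and> (\<forall>\<beta>\<in>B. s \<le> \<beta>)"
proof -
  let ?T = "insert lo A"
  have "bdd_above ?T"
    using assms(1,2) by (intro bdd_aboveI[of _ hi]) auto
  then have upper: "\<tau> \<le> Sup ?T" if "\<tau> \<in> ?T" for \<tau>
    using that by (rule cSup_upper[rotated])
  moreover have least: "Sup ?T \<le> r" if "\<And>\<tau>. \<tau> \<in> ?T \<Longrightarrow> \<tau> \<le> r" for r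
    using that by (intro cSup_least) auto
  moreover have "Sup ?T \<le> hi"
    using assms(1,2) by (intro least) auto
  moreover have "Sup ?T \<le> \<beta>" if "\<beta> \<in> B" for \<beta>
    using that assms(3,4) by (intro least) auto
  ultimately show ?thesis by (intro bexI[of _ "Sup ?T"]) auto
qed

lemma convexlike_on_pair_alternative:
  assumes "convexlike_on V {a, b}" and nonneg: "\<And>v. v \<in> V \<Longrightarrow> 0 \<le> a v \<or> 0 \<le> b v"
  shows "\<exists>s\<in>{0..1}. \<forall>v\<in>V. 0 \<le> s * a v + (1 - s) * b v"
proof -
  \<comment> \<open>The weight at which \<open>s * a v + (1 - s) * b v\<close> vanishes: a lower bound for admissible
    weights where \<open>b v < 0\<close>, an upper bound where \<open>a v < 0\<close>.\<close>
  define \<theta> where "\<theta> v = b v / (b v - a v)" for v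
  define lower where "lower = \<theta> ` {v \<in> V. b v < 0}"
  define upper where "upper = \<theta> ` {v \<in> V. a v < 0}"
  have "lower \<subseteq> {0..1}" "upper \<subseteq> {0..1}"
    using nonneg by (force simp: lower_def upper_def \<theta>_def divide_simps)+
  moreover have "\<alpha> \<le> \<beta>" if "\<alpha> \<in> lower" "\<beta> \<in> upper" for \<alpha> \<beta>
    using that convexlike_on_pair_crossing_le[OF assms] by (auto simp: lower_def upper_def \<theta>_def)
  ultimately obtain s where s: "s \<in> {0..1}"
    and lower: "\<And>\<alpha>. \<alpha> \<in> lower \<Longrightarrow> \<alpha> \<le> s" and upper: "\<And>\<beta>. \<beta> \<in> upper \<Longrightarrow> s \<le> \<beta>"
    using exists_between_subsets_atLeastAtMost[of 0 1 lower upper] by auto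
  have "0 \<le> s * a v + (1 - s) * b v" if v: "v \<in> V" for v
  proof -
    consider (a_neg) "a v < 0" | (b_neg) "b v < 0" | (both_nonneg) "0 \<le> a v" "0 \<le> b v"
      by linarith
    then show ?thesis
    proof cases
      case a_neg
      then have "s \<le> \<theta> v" using upper v by (simp add: upper_def)
      with a_neg nonneg[OF v] show ?thesis by (simp add: \<theta>_def field_simps)
    next
      case b_neg
      then have "\<theta> v \<le> s" using lower v by (simp add: lower_def)
      with b_neg nonneg[OF v] show ?thesis by (simp add: \<theta>_def field_simps)
    next
      case both_nonneg
      with s show ?thesis by simp
    qed
  qed
  with s show ?thesis by blast
qed

lemma prob_simplex_insert:
  assumes "\<sigma> \<in> prob_simplex Q" and "finite Q" and "q \<notin> Q" and "s \<in> {0..1}"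
  obtains \<pi> where "\<pi> \<in> prob_simplex (insert q Q)"
    and "\<And>f. (\<Sum>p\<in>insert q Q. \<pi> p * f p) = s * f q + (1 - s) * (\<Sum>p\<in>Q. \<sigma> p * f p)"
proof -
  define \<pi> where "\<pi> = (\<lambda>p\<in>insert q Q. if p = q then s else (1 - s) * \<sigma> p)"
  have sum_\<pi>: "(\<Sum>p\<in>insert q Q. \<pi> p * f p) = s * f q + (1 - s) * (\<Sum>p\<in>Q. \<sigma> p * f p)" for f
  proof -
    have "(\<Sum>p\<in>Q. \<pi> p * f p) = (\<Sum>p\<in>Q. (1 - s) * (\<sigma> p * f p))"
      using assms(3) by (intro sum.cong) (auto simp: \<pi>_def)
    then show ?thesis
      using assms(2,3) by (simp add: \<pi>_def sum_distrib_left)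
  qed
  have "\<pi> \<in> prob_simplex (insert q Q)"
    using sum_\<pi>[of "\<lambda>_. 1"] assms(1,4) by (auto simp: prob_simplex_def \<pi>_def)
  then show thesis using sum_\<pi> by (rule that)
qed

lemma convexlike_on_alternative:
  fixes F :: "'p \<Rightarrow> 'v \<Rightarrow> real"
  assumes "finite P" and "P \<noteq> {}" and "convexlike_on V (F ` P)"
    and "\<And>v. v \<in> V \<Longrightarrow> \<exists>p\<in>P. 0 \<le> F p v"
  shows "\<exists>\<pi>\<in>prob_simplex P. \<forall>v\<in>V. 0 \<le> (\<Sum>p\<in>P. \<pi> p * F p v)"
  using assms
proof (induction P arbitrary: V rule: finite_ne_induct)
  case (singleton q)
  then show ?case
    by (intro bexI[of _ "\<lambda>p\<in>{q}. 1"]) (auto simp: prob_simplex_def)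
next
  case (insert q Q)
  let ?V0 = "{v \<in> V. F q v < 0}"
  have "convexlike_on ?V0 (F ` Q)"
    using insert.prems(1)
    by (intro convexlike_on_subset[OF convexlike_on_strict_sublevel]) auto
  moreover have "\<exists>p\<in>Q. 0 \<le> F p v" if "v \<in> ?V0" for v
    using insert.prems(2)[of v] that by auto
  ultimately obtain \<sigma> where \<sigma>: "\<sigma> \<in> prob_simplex Q"
    and \<sigma>_nonneg: "\<And>v. v \<in> ?V0 \<Longrightarrow> 0 \<le> (\<Sum>p\<in>Q. \<sigma> p * F p v)"
    using insert.IH by blast
  let ?G = "\<lambda>v. \<Sum>p\<in>Q. \<sigma> p * F p v"
  have "convexlike_on V (insert ?G (F ` insert q Q))"
    using insert.prems(1) \<sigma>
    by (intro convexlike_on_insert_weighted_sum) (auto simp: prob_simplex_def)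
  then have "convexlike_on V {F q, ?G}"
    by (rule convexlike_on_subset) auto
  moreover have "0 \<le> F q v \<or> 0 \<le> ?G v" if "v \<in> V" for v
    using \<sigma>_nonneg[of v] that by (cases "F q v < 0") auto
  ultimately obtain s where s: "s \<in> {0..1}"
    and nonneg: "\<forall>v\<in>V. 0 \<le> s * F q v + (1 - s) * ?G v"
    by (blast dest: convexlike_on_pair_alternative)
  obtain \<pi> where "\<pi> \<in> prob_simplex (insert q Q)"
    and "\<And>f. (\<Sum>p\<in>insert q Q. \<pi> p * f p) = s * f q + (1 - s) * (\<Sum>p\<in>Q. \<sigma> p * f p)"
    using \<sigma> insert.hyps(1,3) s by (rule prob_simplex_insert) blast
  then show ?case
    using nonneg by (intro bexI[of _ \<pi>]) simp_all
qed

lemma prob_simplex_sum_le_SUP: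
  assumes "\<pi> \<in> prob_simplex P" and "finite P"
  shows "ereal (\<Sum>p\<in>P. \<pi> p * f p) \<le> (SUP p\<in>P. ereal (f p))"
proof -
  have "P \<noteq> {}" using assms(1) by (auto simp: prob_simplex_def)
  then obtain q where q: "q \<in> P" "f q = (MAX p\<in>P. f p)"
    using obtains_MAX[OF assms(2), of f] by metis
  have "(\<Sum>p\<in>P. \<pi> p * f p) \<le> (\<Sum>p\<in>P. \<pi> p * f q)"
    using assms by (intro sum_mono mult_left_mono) (auto simp: prob_simplex_def q(2))
  also have "\<dots> = f q"
    using assms(1) by (simp add: prob_simplex_def flip: sum_distrib_right)
  finally show ?thesis using q(1) by (intro SUP_upper2) auto
qed

theorem minimax_prob_simplex:
  fixes F :: "'p \<Rightarrow> 'v \<Rightarrow> real"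
  assumes "finite P" and "P \<noteq> {}" and "convexlike_on V (F ` P)"
  shows "(SUP \<pi>\<in>prob_simplex P. INF v\<in>V. ereal (\<Sum>p\<in>P. \<pi> p * F p v))
       = (INF v\<in>V. SUP p\<in>P. ereal (F p v))" (is "?maxmin = ?minmax")
proof (rule antisym)
  show "?maxmin \<le> ?minmax"
    using assms(1) by (intro SUP_least INF_mono') (rule prob_simplex_sum_le_SUP)
  show "?minmax \<le> ?maxmin"
  proof (rule ccontr)
    assume "\<not> ?thesis"
    then obtain \<alpha> where \<alpha>: "?maxmin < ereal \<alpha>" "ereal \<alpha> < ?minmax"
      using ereal_dense2 by (auto simp: not_le)
    have "\<exists>p\<in>P. 0 \<le> F p v - \<alpha>" if "v \<in> V" for v
      using less_INF_D[OF \<alpha>(2) that] by (auto simp: less_SUP_iff intro: less_imp_le)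
    then obtain \<pi> where \<pi>: "\<pi> \<in> prob_simplex P"
      and nonneg: "\<And>v. v \<in> V \<Longrightarrow> 0 \<le> (\<Sum>p\<in>P. \<pi> p * (F p v - \<alpha>))"
      using convexlike_on_alternative[OF assms(1,2) convexlike_on_diff_const[OF assms(3)]] by blast
    have "\<alpha> \<le> (\<Sum>p\<in>P. \<pi> p * F p v)" if "v \<in> V" for v
      using nonneg[OF that] \<pi>
      by (simp add: prob_simplex_def right_diff_distrib sum_subtractf flip: sum_distrib_right)
    then have "ereal \<alpha> \<le> ?maxmin"
      using \<pi> by (intro SUP_upper2[OF \<pi>] INF_greatest) simp
    with \<alpha>(1) show False by simp
  qed
qed

section \<open>The Lagrangian of the constrained problem\<close>

lemma exists_PiE_sum_mult_eq:
  fixes e :: "'k \<Rightarrow> real"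
  assumes "finite K" and "j \<in> K" and "e j \<noteq> 0" and "0 \<in> A" and "b / e j \<in> A"
  shows "\<exists>m\<in>K \<rightarrow>\<^sub>E A. (\<Sum>k\<in>K. m k * e k) = b"
proof (rule bexI)
  let ?m = "\<lambda>k\<in>K. if k = j then b / e j else 0"
  have "(\<Sum>k\<in>K. ?m k * e k) = (\<Sum>k\<in>K. if k = j then b else 0)"
    using assms(3) by (intro sum.cong) auto
  then show "(\<Sum>k\<in>K. ?m k * e k) = b"
    using assms(1,2) by simp
  show "?m \<in> K \<rightarrow>\<^sub>E A"
    using assms(4,5) by auto
qed

context
  fixes P :: "'p set" and U :: "'u::real_vector set" and R :: "'p \<Rightarrow> 'u \<Rightarrow> real"
    and K1 K2 :: nat and g h :: "nat \<Rightarrow> 'p \<Rightarrow> real" and c d :: "nat \<Rightarrow> real"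
begin

definition lagrangian :: "'p \<Rightarrow> (nat \<Rightarrow> real) \<times> (nat \<Rightarrow> real) \<times> 'u \<Rightarrow> real" where
  "lagrangian p = (\<lambda>(l, \<rho>, u).
     R p u + (\<Sum>k=1..K1. l k * (g k p - c k)) + (\<Sum>k=1..K2. \<rho> k * (h k p - d k)))"

definition lagrangian_domain :: "((nat \<Rightarrow> real) \<times> (nat \<Rightarrow> real) \<times> 'u) set" where
  "lagrangian_domain = ({1..K1} \<rightarrow>\<^sub>E UNIV) \<times> ({1..K2} \<rightarrow>\<^sub>E {..0}) \<times> U"

lemma feasible_set_iff_lagrangian_le:
  "(l, \<rho>, t, u) \<in> feasible_set P U R K1 K2 g h \<longleftrightarrow>
     (l, \<rho>, u) \<in> lagrangian_domain \<and>
     (\<forall>p\<in>P. lagrangian p (l, \<rho>, u) \<le> objective K1 K2 c d (l, \<rho>, t, u))"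
  unfolding feasible_set_def lagrangian_domain_def lagrangian_def objective_def
    right_diff_distrib sum_subtractf
  by (auto simp: PiE_iff le_diff_eq)

lemma INF_objective_eq_INF_SUP_lagrangian:
  assumes "finite P" and "P \<noteq> {}"
  shows "(INF x\<in>feasible_set P U R K1 K2 g h. ereal (objective K1 K2 c d x))
       = (INF v\<in>lagrangian_domain. SUP p\<in>P. ereal (lagrangian p v))" (is "?program = ?minmax")
proof (rule antisym)
  show "?program \<le> ?minmax"
  proof (rule INF_greatest)
    fix v assume v: "v \<in> lagrangian_domain"
    obtain l \<rho> u where v_eq: "v = (l, \<rho>, u)" by (cases v)
    obtain q where q: "q \<in> P" "lagrangian q v = (MAX p\<in>P. lagrangian p v)"
      using obtains_MAX[OF assms, of "\<lambda>p. lagrangian p v"] by metis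
    then have max: "\<forall>p\<in>P. lagrangian p v \<le> lagrangian q v"
      using assms(1) by simp
    define x where "x = (l, \<rho>, lagrangian q v + (\<Sum>k=1..K1. l k * c k) + (\<Sum>k=1..K2. \<rho> k * d k), u)"
    have objective_x: "objective K1 K2 c d x = lagrangian q v"
      by (simp add: x_def objective_def)
    then have "x \<in> feasible_set P U R K1 K2 g h"
      using v max unfolding x_def v_eq feasible_set_iff_lagrangian_le by simp
    then have "?program \<le> ereal (lagrangian q v)"
      by (rule INF_lower2) (simp add: objective_x)
    also have "\<dots> \<le> (SUP p\<in>P. ereal (lagrangian p v))"
      using q(1) by (rule SUP_upper)
    finally show "?program \<le> (SUP p\<in>P. ereal (lagrangian p v))" .
  qed
  show "?minmax \<le> ?program"
  proof (rule INF_greatest)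
    fix x assume x: "x \<in> feasible_set P U R K1 K2 g h"
    obtain l \<rho> t u where x_eq: "x = (l, \<rho>, t, u)" by (cases x)
    show "?minmax \<le> ereal (objective K1 K2 c d x)"
      using x unfolding x_eq feasible_set_iff_lagrangian_le
      by (intro INF_lower2[of "(l, \<rho>, u)"] SUP_least) auto
  qed
qed

lemma sum_lagrangian:
  assumes "\<pi> \<in> prob_simplex P"
  shows "(\<Sum>p\<in>P. \<pi> p * lagrangian p (l, \<rho>, u)) = (\<Sum>p\<in>P. \<pi> p * R p u)
           + (\<Sum>k=1..K1. l k * ((\<Sum>p\<in>P. g k p * \<pi> p) - c k))
           + (\<Sum>k=1..K2. \<rho> k * ((\<Sum>p\<in>P. h k p * \<pi> p) - d k))"
proof -
  have swap: "(\<Sum>p\<in>P. \<pi> p * (\<Sum>k=1..K. m k * (f k p - e k)))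
      = (\<Sum>k=1..K. m k * ((\<Sum>p\<in>P. f k p * \<pi> p) - e k))"
    for K :: nat and m e :: "nat \<Rightarrow> real" and f
  proof -
    have "(\<Sum>p\<in>P. \<pi> p * (\<Sum>k=1..K. m k * (f k p - e k)))
        = (\<Sum>k=1..K. m k * (\<Sum>p\<in>P. f k p * \<pi> p - e k * \<pi> p))"
      unfolding sum_distrib_left by (subst sum.swap) (simp add: algebra_simps)
    then show ?thesis
      using assms by (simp add: prob_simplex_def sum_subtractf flip: sum_distrib_left)
  qed
  show ?thesis
    by (simp only: lagrangian_def prod.case distrib_left sum.distrib swap)
qed

lemma INF_lagrangian_constrained_simplex:
  assumes "\<pi> \<in> constrained_simplex P K1 K2 g h c d"
  shows "(INF v\<in>lagrangian_domain. ereal (\<Sum>p\<in>P. \<pi> p * lagrangian p v))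
       = (INF u\<in>U. ereal (\<Sum>p\<in>P. \<pi> p * R p u))" (is "?relaxed = ?inner")
proof (rule antisym)
  have simplex: "\<pi> \<in> prob_simplex P"
    and eq: "\<And>k. k \<in> {1..K1} \<Longrightarrow> (\<Sum>p\<in>P. g k p * \<pi> p) = c k"
    and le: "\<And>k. k \<in> {1..K2} \<Longrightarrow> (\<Sum>p\<in>P. h k p * \<pi> p) \<le> d k"
    using assms by (auto simp: constrained_simplex_def)
  show "?relaxed \<le> ?inner"
  proof (rule INF_greatest)
    fix u assume "u \<in> U"
    then have "(\<lambda>k\<in>{1..K1}. 0, \<lambda>k\<in>{1..K2}. 0, u) \<in> lagrangian_domain"
      by (auto simp: lagrangian_domain_def)
    then show "?relaxed \<le> ereal (\<Sum>p\<in>P. \<pi> p * R p u)"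
      by (rule INF_lower2) (simp add: sum_lagrangian[OF simplex])
  qed
  show "?inner \<le> ?relaxed"
  proof (rule INF_greatest)
    fix v assume v: "v \<in> lagrangian_domain"
    obtain l \<rho> u where v_eq: "v = (l, \<rho>, u)" by (cases v)
    have "u \<in> U" and \<rho>: "\<And>k. k \<in> {1..K2} \<Longrightarrow> \<rho> k \<le> 0"
      using v by (auto simp: v_eq lagrangian_domain_def)
    have "0 \<le> (\<Sum>k=1..K2. \<rho> k * ((\<Sum>p\<in>P. h k p * \<pi> p) - d k))"
      using \<rho> le by (intro sum_nonneg mult_nonpos_nonpos) auto
    then have "(\<Sum>p\<in>P. \<pi> p * R p u) \<le> (\<Sum>p\<in>P. \<pi> p * lagrangian p v)"
      using eq by (simp add: v_eq sum_lagrangian[OF simplex])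
    with \<open>u \<in> U\<close> show "?inner \<le> ereal (\<Sum>p\<in>P. \<pi> p * lagrangian p v)"
      by (intro INF_lower2) auto
  qed
qed

lemma INF_lagrangian_infeasible:
  assumes "U \<noteq> {}" and "\<pi> \<in> prob_simplex P" and "\<pi> \<notin> constrained_simplex P K1 K2 g h c d"
  shows "(INF v\<in>lagrangian_domain. ereal (\<Sum>p\<in>P. \<pi> p * lagrangian p v)) = -\<infinity>"
proof (rule ereal_bot)
  fix B :: real
  obtain u where u: "u \<in> U" using assms(1) by blast
  define b where "b = min 0 (B - (\<Sum>p\<in>P. \<pi> p * R p u))"
  define excess_g where "excess_g k = (\<Sum>p\<in>P. g k p * \<pi> p) - c k" for k
  define excess_h where "excess_h k = (\<Sum>p\<in>P. h k p * \<pi> p) - d k" for k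
  consider (equality_violated) j where "j \<in> {1..K1}" "excess_g j \<noteq> 0"
    | (inequality_violated) j where "j \<in> {1..K2}" "0 < excess_h j"
    using assms(2,3) by (force simp: constrained_simplex_def excess_g_def excess_h_def)
  then obtain l \<rho> where v: "(l, \<rho>, u) \<in> lagrangian_domain"
    and penalty: "(\<Sum>k=1..K1. l k * excess_g k) + (\<Sum>k=1..K2. \<rho> k * excess_h k) = b"
  proof cases
    case (equality_violated j)
    then obtain l where "l \<in> {1..K1} \<rightarrow>\<^sub>E UNIV" "(\<Sum>k=1..K1. l k * excess_g k) = b"
      using exists_PiE_sum_mult_eq[of "{1..K1}" j excess_g UNIV b] by auto
    with u show thesis
      by (intro that[of l "\<lambda>k\<in>{1..K2}. 0"]) (auto simp: lagrangian_domain_def)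
  next
    case (inequality_violated j)
    then have "b / excess_h j \<le> 0" by (simp add: b_def divide_simps)
    with inequality_violated obtain \<rho>
      where "\<rho> \<in> {1..K2} \<rightarrow>\<^sub>E {..0}" "(\<Sum>k=1..K2. \<rho> k * excess_h k) = b"
      using exists_PiE_sum_mult_eq[of "{1..K2}" j excess_h "{..0}" b] by auto
    with u show thesis
      by (intro that[of "\<lambda>k\<in>{1..K1}. 0" \<rho>]) (auto simp: lagrangian_domain_def)
  qed
  have "(\<Sum>p\<in>P. \<pi> p * lagrangian p (l, \<rho>, u)) = (\<Sum>p\<in>P. \<pi> p * R p u) + b"
    using penalty by (simp add: sum_lagrangian[OF assms(2)] excess_g_def excess_h_def)
  also have "\<dots> \<le> B" by (simp add: b_def)
  finally show "(INF v\<in>lagrangian_domain. ereal (\<Sum>p\<in>P. \<pi> p * lagrangian p v)) \<le> ereal B"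
    using v by (intro INF_lower2) auto
qed

lemma SUP_constrained_simplex_eq_SUP_INF_lagrangian:
  assumes "U \<noteq> {}"
  shows "(SUP \<pi>\<in>constrained_simplex P K1 K2 g h c d. INF u\<in>U. ereal (\<Sum>p\<in>P. \<pi> p * R p u))
       = (SUP \<pi>\<in>prob_simplex P. INF v\<in>lagrangian_domain. ereal (\<Sum>p\<in>P. \<pi> p * lagrangian p v))"
    (is "?robust = ?maxmin")
proof (rule antisym)
  have "constrained_simplex P K1 K2 g h c d \<subseteq> prob_simplex P"
    by (auto simp: constrained_simplex_def)
  then show "?robust \<le> ?maxmin"
    by (intro SUP_subset_mono) (simp_all add: INF_lagrangian_constrained_simplex)
  show "?maxmin \<le> ?robust"
  proof (rule SUP_least)
    fix \<pi> assume \<pi>: "\<pi> \<in> prob_simplex P"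
    show "(INF v\<in>lagrangian_domain. ereal (\<Sum>p\<in>P. \<pi> p * lagrangian p v)) \<le> ?robust"
    proof (cases "\<pi> \<in> constrained_simplex P K1 K2 g h c d")
      case True
      then show ?thesis
        by (subst INF_lagrangian_constrained_simplex) (auto intro: SUP_upper)
    next
      case False
      then show ?thesis
        by (subst INF_lagrangian_infeasible[OF assms \<pi>]) auto
    qed
  qed
qed

section \<open>Convexity of the Lagrangian and of the program\<close>

lemma sum_restrict_comb:
  fixes m m' e :: "nat \<Rightarrow> real"
  shows "(\<Sum>k=1..K. (\<lambda>k\<in>{1..K}. (1 - s) * m k + s * m' k) k * e k)
       = (1 - s) * (\<Sum>k=1..K. m k * e k) + s * (\<Sum>k=1..K. m' k * e k)"
  unfolding sum_distrib_left sum.distrib[symmetric] by (intro sum.cong) (auto simp: algebra_simps)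

lemma objective_tuple_comb:
  "objective K1 K2 c d (tuple_comb K1 K2 s x y)
     = (1 - s) * objective K1 K2 c d x + s * objective K1 K2 c d y"
  unfolding objective_def tuple_comb_def split_def prod.sel sum_restrict_comb
  by (simp add: algebra_simps)

context
  fixes l l' l'' \<rho> \<rho>' \<rho>'' :: "nat \<Rightarrow> real" and u u' u'' :: 'u and t t' t'' s :: real
  assumes comb: "tuple_comb K1 K2 s (l, \<rho>, t, u) (l', \<rho>', t', u') = (l'', \<rho>'', t'', u'')"
    and s: "s \<in> {0..1}"
    and domain: "(l, \<rho>, u) \<in> lagrangian_domain" "(l', \<rho>', u') \<in> lagrangian_domain"
begin

lemma lagrangian_domain_tuple_comb:
  assumes "convex U"
  shows "(l'', \<rho>'', u'') \<in> lagrangian_domain"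
proof -
  have "(1 - s) *\<^sub>R u + s *\<^sub>R u' \<in> U"
    using domain s assms by (intro convexD) (auto simp: lagrangian_domain_def)
  moreover have "(1 - s) * \<rho> k + s * \<rho>' k \<le> 0" if "k \<in> {1..K2}" for k
    using domain s that
    by (intro convex_bound_le) (auto simp: lagrangian_domain_def)
  ultimately show ?thesis
    using comb by (auto simp: tuple_comb_def lagrangian_domain_def)
qed

lemma lagrangian_tuple_comb_le:
  assumes "convex_on U (R p)"
  shows "lagrangian p (l'', \<rho>'', u'')
           \<le> (1 - s) * lagrangian p (l, \<rho>, u) + s * lagrangian p (l', \<rho>', u')"
proof -
  have eqs: "l'' = (\<lambda>k\<in>{1..K1}. (1 - s) * l k + s * l' k)"
    "\<rho>'' = (\<lambda>k\<in>{1..K2}. (1 - s) * \<rho> k + s * \<rho>' k)" "u'' = (1 - s) *\<^sub>R u + s *\<^sub>R u'"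
    using comb by (auto simp: tuple_comb_def)
  have "R p u'' \<le> (1 - s) * R p u + s * R p u'"
    unfolding eqs using domain s assms by (intro convex_onD) (auto simp: lagrangian_domain_def)
  then show ?thesis
    unfolding lagrangian_def prod.case eqs(1,2) sum_restrict_comb by (simp add: algebra_simps)
qed

end

lemma convexlike_on_lagrangian:
  assumes "convex U" and "\<And>p. p \<in> P \<Longrightarrow> convex_on U (R p)"
  shows "convexlike_on lagrangian_domain (lagrangian ` P)"
  unfolding convexlike_on_def
proof (intro ballI)
  fix v w and s :: real
  assume v: "v \<in> lagrangian_domain" and w: "w \<in> lagrangian_domain" and s: "s \<in> {0..1}"
  obtain l \<rho> u where v_eq: "v = (l, \<rho>, u)" by (cases v)
  obtain l' \<rho>' u' where w_eq: "w = (l', \<rho>', u')" by (cases w)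
  obtain l'' \<rho>'' t'' u''
    where comb: "tuple_comb K1 K2 s (l, \<rho>, 0, u) (l', \<rho>', 0, u') = (l'', \<rho>'', t'', u'')"
    by (metis prod_cases4)
  note combine = comb s v[unfolded v_eq] w[unfolded w_eq]
  show "\<exists>z\<in>lagrangian_domain. \<forall>f\<in>lagrangian ` P. f z \<le> (1 - s) * f v + s * f w"
    using lagrangian_domain_tuple_comb[OF combine assms(1)]
      lagrangian_tuple_comb_le[OF combine assms(2)]
    by (auto simp: v_eq w_eq)
qed

lemma convex_program_feasible_set:
  assumes "convex U" and "\<And>p. p \<in> P \<Longrightarrow> convex_on U (R p)"
  shows "convex_program K1 K2 (feasible_set P U R K1 K2 g h) (objective K1 K2 c d)"
proof -
  have "tuple_comb K1 K2 s x y \<in> feasible_set P U R K1 K2 g h"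
    if x: "x \<in> feasible_set P U R K1 K2 g h" and y: "y \<in> feasible_set P U R K1 K2 g h"
      and s: "s \<in> {0..1}" for x y s
  proof -
    let ?f = "objective K1 K2 c d"
    obtain l \<rho> t u where x_eq: "x = (l, \<rho>, t, u)" by (cases x)
    obtain l' \<rho>' t' u' where y_eq: "y = (l', \<rho>', t', u')" by (cases y)
    obtain l'' \<rho>'' t'' u'' where comb: "tuple_comb K1 K2 s x y = (l'', \<rho>'', t'', u'')"
      by (metis prod_cases4)
    note x = x[unfolded x_eq feasible_set_iff_lagrangian_le]
    note y = y[unfolded y_eq feasible_set_iff_lagrangian_le]
    note combine = comb[unfolded x_eq y_eq] s x[THEN conjunct1] y[THEN conjunct1]
    have "lagrangian p (l'', \<rho>'', u'') \<le> ?f (l'', \<rho>'', t'', u'')" if p: "p \<in> P" for p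
    proof -
      have "lagrangian p (l'', \<rho>'', u'')
          \<le> (1 - s) * lagrangian p (l, \<rho>, u) + s * lagrangian p (l', \<rho>', u')"
        using combine assms(2)[OF p] by (rule lagrangian_tuple_comb_le)
      also have "\<dots> \<le> (1 - s) * ?f x + s * ?f y"
        using x y p s by (intro add_mono mult_left_mono) (auto simp: x_eq y_eq)
      also have "\<dots> = ?f (l'', \<rho>'', t'', u'')"
        by (simp add: objective_tuple_comb flip: comb)
      finally show ?thesis .
    qed
    with lagrangian_domain_tuple_comb[OF combine assms(1)] show ?thesis
      by (simp add: comb feasible_set_iff_lagrangian_le)
  qed
  then show ?thesis
    by (auto simp: convex_program_def objective_tuple_comb)
qed

end

theorem mainTheorem10:
  fixes P :: "(real ^ 'i) set"
    and U :: "(real ^ 'm) set"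
    and R :: "real ^ 'i \<Rightarrow> real ^ 'm \<Rightarrow> real"
    and K1 K2 :: nat
    and g h :: "nat \<Rightarrow> real ^ 'i \<Rightarrow> real"
    and c d :: "nat \<Rightarrow> real"
  assumes "finite P" and "P \<noteq> {}" and "\<forall>p\<in>P. \<forall>i. 0 \<le> p $ i"
    and "convex U" and "U \<noteq> {}"
    and "\<forall>p\<in>P. convex_on U (R p)"
    and "constrained_simplex P K1 K2 g h c d \<noteq> {}"
  shows "(SUP \<pi>\<in>constrained_simplex P K1 K2 g h c d.
            INF u\<in>U. ereal (\<Sum>p\<in>P. \<pi> p * R p u))
         = (INF x\<in>feasible_set P U R K1 K2 g h. ereal (objective K1 K2 c d x))
       \<and> convex_program K1 K2 (feasible_set P U R K1 K2 g h) (objective K1 K2 c d)"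
proof
  let ?V = "lagrangian_domain U K1 K2" and ?L = "lagrangian R K1 K2 g h c d"
  have convex_R: "\<And>p. p \<in> P \<Longrightarrow> convex_on U (R p)"
    using assms(6) by blast
  have "(SUP \<pi>\<in>constrained_simplex P K1 K2 g h c d. INF u\<in>U. ereal (\<Sum>p\<in>P. \<pi> p * R p u))
      = (SUP \<pi>\<in>prob_simplex P. INF v\<in>?V. ereal (\<Sum>p\<in>P. \<pi> p * ?L p v))"
    using assms(5) by (rule SUP_constrained_simplex_eq_SUP_INF_lagrangian)
  also have "\<dots> = (INF v\<in>?V. SUP p\<in>P. ereal (?L p v))"
    using assms(1,2) convexlike_on_lagrangian[OF assms(4) convex_R] by (rule minimax_prob_simplex)
  also have "\<dots> = (INF x\<in>feasible_set P U R K1 K2 g h. ereal (objective K1 K2 c d x))"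
    using assms(1,2) by (rule INF_objective_eq_INF_SUP_lagrangian[symmetric])
  finally show "(SUP \<pi>\<in>constrained_simplex P K1 K2 g h c d. INF u\<in>U. ereal (\<Sum>p\<in>P. \<pi> p * R p u))
      = (INF x\<in>feasible_set P U R K1 K2 g h. ereal (objective K1 K2 c d x))" .
  show "convex_program K1 K2 (feasible_set P U R K1 K2 g h) (objective K1 K2 c d)"
    using assms(4) convex_R by (rule convex_program_feasible_set)
qed

end
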